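(* For $|q|<1$, $$\sum_{m,k,n\geq0} \frac{q^{k^2+(m+k)^2+n^2}}{(q)_m(q)_{2k}}\begin{bmatrix} k\\ n\end{bmatrix}_q=\frac{(q^{21},q^{10},q^{11};q^{21})_\infty}{(q)_\infty}.$$
   Context: For $m$ a nonnegative integer, $(a)_m=(a;q)_m=\prod_{j=0}^{m-1}(1-aq^j)$ (with $(a)_0=1$), $(a;q)_\infty=\prod_{j\ge0}(1-aq^j)$, $(q)_\infty=(q;q)_\infty$, and $(a_1,\ldots,a_r;q)_\infty=(a_1;q)_\infty\cdots(a_r;q)_\infty$. In particular $(q)_m=\prod_{j=1}^m(1-q^j)$. The $q$-binomial coefficient is $\begin{bmatrix} m+n\\ m\end{bmatrix}_q=\frac{(q)_{m+n}}{(q)_m(q)_n}$ if $m,n$ are nonnegative integers, and it is $0$ otherwise (so $\begin{bmatrix} A\\ B\end{bmatrix}_q=0$ unless $0\le B\le A$). *)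

theory Defs
  imports "HOL-Analysis.Analysis"
begin

definition qpoch :: "complex \<Rightarrow> complex \<Rightarrow> nat \<Rightarrow> complex" where
  "qpoch a q m = (\<Prod>j<m. 1 - a * q ^ j)"

definition qpoch_inf :: "complex \<Rightarrow> complex \<Rightarrow> complex" where
  "qpoch_inf a q = (\<Prod>j. 1 - a * q ^ j)"

lemma qpoch_inf_has_prod:
  assumes "norm q < 1"
  shows "(\<lambda>j. 1 - a * q ^ j) has_prod qpoch_inf a q"
proof -
  have "summable (\<lambda>j. norm ((1 - a * q ^ j) - 1))"
    using assms by (simp add: norm_mult norm_power summable_mult summable_geometric)
  then have "abs_convergent_prod (\<lambda>j. 1 - a * q ^ j)"
    by (simp only: abs_convergent_prod_conv_summable)
  then show ?thesis
    unfolding qpoch_inf_def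
    by (intro convergent_prod_has_prod abs_convergent_prod_imp_convergent_prod)
qed

definition qpoch_inf_list :: "complex list \<Rightarrow> complex \<Rightarrow> complex" where
  "qpoch_inf_list as q = (\<Prod>a\<leftarrow>as. qpoch_inf a q)"

definition qbinom :: "complex \<Rightarrow> nat \<Rightarrow> nat \<Rightarrow> complex" where
  "qbinom q A B =
     (if B \<le> A then qpoch q q A / (qpoch q q B * qpoch q q (A - B)) else 0)"

end

theory Submission
  imports Defs
begin

text \<open>
  Bressoud's finite form of the Rogers--Ramanujan identity,
  \<open>\<Sum>n. q^(n^2) [k, n] = \<Sum>j. (-1)^j q^(j(5j+1)/2) [2k, k+2j]\<close>, exhibits the summand over \<open>n\<close>,
  divided by \<open>(q)_{2k}\<close>, as the \<open>\<beta>\<close>-side of a Bailey pair supported on even indices \<open>2j\<close>.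
  Put \<open>L = m + k\<close>. Summing over \<open>k\<close> and then over \<open>L\<close> applies the Bailey lemma twice, each time
  producing a factor \<open>q^((2j)^2)\<close>, so the triple sum equals
  \<open>\<Sum>j. (-1)^j q^((21 j^2 + j)/2) / (q)_\<infinity>\<close>, and Jacobi's triple product in base \<open>q^21\<close> applies.
  Bressoud's identity is proved by showing that its two sides, together with those of the companion
  \<open>\<Sum>n. q^(n^2+n) [k, n] = \<Sum>j. (-1)^j q^(j(5j+3)/2) [2k+1, k+1+2j]\<close>, satisfy the same first-order
  system in \<open>k\<close>.
\<close>

section \<open>Gaussian binomial coefficients with integer lower index\<close>

lemma qpoch_Suc: "qpoch a q (Suc n) = qpoch a q n * (1 - a * q ^ n)"
  by (simp add: qpoch_def)

lemma one_minus_power_nonzero: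
  fixes q :: complex
  assumes "norm q < 1"
  shows "1 - q * q ^ n \<noteq> 0"
proof
  assume "1 - q * q ^ n = 0"
  then have "norm (q ^ Suc n) = 1"
    by simp
  moreover have "norm (q ^ Suc n) < 1"
    unfolding norm_power
    using power_Suc_le_self[of "norm q" n] assms by (intro le_less_trans[OF _ assms]) auto
  ultimately show False
    by simp
qed

lemma qpoch_nonzero: "norm q < 1 \<Longrightarrow> qpoch q q n \<noteq> 0"
  using one_minus_power_nonzero by (auto simp: qpoch_def)

section \<open>Triangular numbers and signs at integer arguments\<close>

definition tri :: "int \<Rightarrow> int" where
  "tri j = j * (j + 1) div 2"

text \<open>The division is exact because \<open>j * (j + 1)\<close> is even. With
  \<open>tri\<close>, the exponents j(5j+1)/2 and j(5j+3)/2 become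
  \<open>2 * (j * j) + tri j\<close> and \<open>2 * (j * j) + j + tri j\<close>.\<close>

lemma two_tri: "2 * tri j = j * j + j"
  by (simp add: tri_def algebra_simps)

lemma tri_uminus: "tri (- j) = tri j - j"
  using two_tri[of j] two_tri[of "- j"] by simp

text \<open>The symmetry axis of \<open>tri\<close> is -1/2. Since \<open>par\<close> changes sign
  under the same reflection, sums that are otherwise symmetric about -1/2 cancel.\<close>

lemma tri_reflect: "tri (- 1 - j) = tri j"
  using two_tri[of j] two_tri[of "- 1 - j"] by (simp add: algebra_simps)

lemma tri_add1: "tri (j + 1) = tri j + j + 1"
  using two_tri[of j] two_tri[of "j + 1"] by (simp add: algebra_simps)

lemma tri_diff1: "tri (j - 1) = tri j - j"
  using two_tri[of j] two_tri[of "j - 1"] by (simp add: algebra_simps)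

definition par :: "int \<Rightarrow> complex" where
  "par j = (if even j then 1 else - 1)"

lemma par_uminus: "par (- j) = par j"
  and par_reflect: "par (- 1 - j) = - par j"
  and par_add1: "par (j + 1) = - par j"
  and par_diff1: "par (j - 1) = - par j"
  and norm_par: "norm (par j) = 1"
  by (auto simp: par_def)

text \<open>Setting \<open>1 / (q)_i = 0\<close> for \<open>i < 0\<close> makes all finite sums below sums over all integers.\<close>

definition rq :: "complex \<Rightarrow> int \<Rightarrow> complex" where
  "rq q i = (if i < 0 then 0 else 1 / qpoch q q (nat i))"

definition gbin :: "complex \<Rightarrow> nat \<Rightarrow> int \<Rightarrow> complex" where
  "gbin q N m = qpoch q q N * rq q m * rq q (int N - m)"

lemma rq_neg: "i < 0 \<Longrightarrow> rq q i = 0"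
  by (simp add: rq_def)

lemma rq_0: "rq q 0 = 1"
  by (simp add: rq_def qpoch_def)

lemma gbin_outside: "m < 0 \<or> int N < m \<Longrightarrow> gbin q N m = 0"
  by (auto simp: gbin_def rq_neg)

lemma gbin_symmetric: "m + m' = int N \<Longrightarrow> gbin q N m = gbin q N m'"
proof -
  assume "m + m' = int N"
  then have "int N - m = m'" "int N - m' = m"
    by auto
  then show ?thesis
    unfolding gbin_def by (metis mult.assoc mult.commute)
qed

section \<open>Rearranging sums over all integers\<close>

lemma finite_support_has_sum:
  fixes f :: "int \<Rightarrow> complex"
  assumes "\<And>j. \<bar>j\<bar> > K \<Longrightarrow> f j = 0"
  obtains s where "(f has_sum s) UNIV"
proof -
  have "(f has_sum (\<Sum>j\<in>{-K..K}. f j)) UNIV"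
    by (rule has_sum_finite_neutralI[where B = "{-K..K}"]) (use assms in auto)
  then show ?thesis
    by (rule that)
qed

lemma has_sum_int_uminus:
  fixes f :: "int \<Rightarrow> complex"
  shows "((\<lambda>j. f (- j)) has_sum s) UNIV \<longleftrightarrow> (f has_sum s) UNIV"
  by (rule has_sum_reindex_bij_witness[where i = uminus and j = uminus]) auto

lemma has_sum_int_shift:
  fixes f :: "int \<Rightarrow> complex"
  shows "((\<lambda>j. f (j + c)) has_sum s) UNIV \<longleftrightarrow> (f has_sum s) UNIV"
  by (rule has_sum_reindex_bij_witness[where i = "\<lambda>j. j - c" and j = "\<lambda>j. j + c"]) auto

lemma has_sum_int_reflect:
  fixes f :: "int \<Rightarrow> complex"
  shows "((\<lambda>j. f (c - j)) has_sum s) UNIV \<longleftrightarrow> (f has_sum s) UNIV"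
  by (rule has_sum_reindex_bij_witness[where i = "\<lambda>j. c - j" and j = "\<lambda>j. c - j"]) auto

context
  fixes q :: complex
  assumes q0: "q \<noteq> 0" and q1: "norm q < 1"
begin

lemma powi_mult: "a + b = c \<Longrightarrow> q powi a * q powi b = q powi c"
  using q0 by (auto simp: power_int_add)

text \<open>This is (q)_i = (q)_{i-1} (1 - q^i) inverted. At \<open>i = 0\<close> the factor
  vanishes, which matches the convention \<open>rq q (- 1) = 0\<close>, so the recurrence holds at
  every integer and no boundary cases arise later.\<close>

lemma rq_pred: "rq q (i - 1) = (1 - q powi i) * rq q i"
proof (cases "i \<le> 0")
  case True
  then show ?thesis
    by (cases "i = 0") (auto simp: rq_neg)
next
  case False
  then obtain n where n: "i = int (Suc n)"
    using zero_less_imp_eq_int[of i] by (metis gr0_conv_Suc linorder_not_le)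
  have "rq q (i - 1) = 1 / qpoch q q n"
    by (simp add: n rq_def)
  also have "\<dots> = (1 - q * q ^ n) * (1 / qpoch q q (Suc n))"
    using qpoch_nonzero[OF q1, of n] one_minus_power_nonzero[OF q1, of n]
    by (simp add: qpoch_Suc)
  also have "q * q ^ n = q powi i"
    unfolding n power_int_of_nat by simp
  also have "1 / qpoch q q (Suc n) = rq q i"
    unfolding n rq_def by (simp del: of_nat_Suc)
  finally show ?thesis .
qed

lemma qpoch_Suc_powi: "qpoch q q (Suc N) = qpoch q q N * (1 - q powi (int N + 1))"
proof -
  have "q powi (int N + 1) = q * q ^ N"
    using power_int_of_nat[of q "Suc N"] by (simp add: add.commute)
  then show ?thesis
    by (simp add: qpoch_Suc)
qed

lemma gbin_pascal: "gbin q (Suc N) m = gbin q N (m - 1) + q powi m * gbin q N m"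
  and gbin_pascal': "gbin q (Suc N) m = q powi (int N + 1 - m) * gbin q N (m - 1) + gbin q N m"
  and gbin_absorb: "(1 - q powi (int N + 1)) * gbin q N m = (1 - q powi (int N + 1 - m)) * gbin q (Suc N) m"
proof -
  \<comment> \<open>All three binomials are multiples of \<open>A\<close>, so each recurrence
    becomes an identity between the multipliers 1 - q^(N+1), 1 - q^m and 1 - q^(N+1-m).\<close>
  define A where "A = qpoch q q N * rq q m * rq q (int N + 1 - m)"
  have P: "q powi m * q powi (int N + 1 - m) = q powi (int N + 1)"
    by (rule powi_mult) simp
  have S: "gbin q (Suc N) m = (1 - q powi (int N + 1)) * A"
    by (simp add: gbin_def A_def qpoch_Suc_powi algebra_simps)
  have L: "gbin q N (m - 1) = (1 - q powi m) * A"
    unfolding gbin_def A_def rq_pred by (simp add: algebra_simps)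
  have R: "gbin q N m = (1 - q powi (int N + 1 - m)) * A"
    using arg_cong[OF rq_pred[of "int N + 1 - m"], of "\<lambda>t. qpoch q q N * rq q m * t"]
    by (simp add: gbin_def A_def mult.assoc mult.left_commute)
  show "gbin q (Suc N) m = gbin q N (m - 1) + q powi m * gbin q N m"
    unfolding S L R P[symmetric] by (simp add: algebra_simps)
  show "gbin q (Suc N) m = q powi (int N + 1 - m) * gbin q N (m - 1) + gbin q N m"
    unfolding S L R P[symmetric] by (simp add: algebra_simps)
  show "(1 - q powi (int N + 1)) * gbin q N m = (1 - q powi (int N + 1 - m)) * gbin q (Suc N) m"
    unfolding S R by (simp add: algebra_simps)
qed

text \<open>Two Pascal steps of opposite type keep the index centred while the top grows by 2. The
  outer coefficients are q^(n+1-m) and q^(n+1+m), the middle one is 1 + q^(2n+1). Both the Bressoud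
  recursion and the finite triple product rest on this.\<close>

lemma gbin_pascal_twice:
  "gbin q (2 * Suc n) (int (Suc n) + m) =
     q powi (int n + 1 - m) * gbin q (2 * n) (int n + m - 1) + gbin q (2 * n) (int n + m) +
     q powi (int n + 1 + m) * (q powi (int n - m) * gbin q (2 * n) (int n + m) + gbin q (2 * n) (int n + 1 + m))"
proof -
  have "gbin q (2 * Suc n) (int (Suc n) + m) =
     gbin q (Suc (2 * n)) (int n + m) + q powi (int n + 1 + m) * gbin q (Suc (2 * n)) (int n + 1 + m)"
    using gbin_pascal[of "Suc (2 * n)" "int n + 1 + m"] by (simp add: algebra_simps)
  also have "gbin q (Suc (2 * n)) (int n + m) =
     q powi (int n + 1 - m) * gbin q (2 * n) (int n + m - 1) + gbin q (2 * n) (int n + m)"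
    using gbin_pascal'[of "2 * n" "int n + m"] by (simp add: algebra_simps)
  also have "gbin q (Suc (2 * n)) (int n + 1 + m) =
     q powi (int n - m) * gbin q (2 * n) (int n + m) + gbin q (2 * n) (int n + 1 + m)"
    using gbin_pascal'[of "2 * n" "int n + 1 + m"] by (simp add: algebra_simps)
  finally show ?thesis .
qed

section \<open>Bressoud's finite Rogers--Ramanujan identity\<close>

text \<open>Half of the comparison with Bressoud's alternating sums: the pair of sums is advanced by
  a first-order system, the very one that \<open>bressoud_step\<close> derives for the other
  side.\<close>

lemma rogers_szego_step:
  assumes A: "((\<lambda>s. q powi (s * s) * gbin q n s) has_sum a) UNIV"
    and B: "((\<lambda>s. q powi (s * s + s) * gbin q n s) has_sum b) UNIV"
  defines "a' \<equiv> a + q powi (int n + 1) * b"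
  shows "((\<lambda>s. q powi (s * s) * gbin q (Suc n) s) has_sum a') UNIV"
    and "((\<lambda>s. q powi (s * s + s) * gbin q (Suc n) s) has_sum
            (q powi (int n + 1) * a' + (1 - q powi (int n + 1)) * b)) UNIV"
proof -
  let ?Q = "q powi (int n + 1)"
  \<comment> \<open>Shifted by one, the companion sum supplies the second Pascal term, since (n+1) +
    (s-1)^2 + (s-1) = s^2 + (n+1-s).\<close>
  have "((\<lambda>s. ?Q * (q powi ((s + - 1) * (s + - 1) + (s + - 1)) * gbin q n (s + - 1))) has_sum ?Q * b) UNIV"
    using has_sum_cmult_right[OF B, of ?Q]
    by (subst has_sum_int_shift[where c = "- 1" and f = "\<lambda>s. ?Q * (q powi (s * s + s) * gbin q n s)"])
  then have "((\<lambda>s. q powi (s * s) * gbin q n s +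
      ?Q * (q powi ((s + - 1) * (s + - 1) + (s + - 1)) * gbin q n (s + - 1))) has_sum a') UNIV"
    unfolding a'_def by (intro has_sum_add A)
  moreover have "q powi (s * s) * gbin q n s +
      ?Q * (q powi ((s + - 1) * (s + - 1) + (s + - 1)) * gbin q n (s + - 1)) =
      q powi (s * s) * gbin q (Suc n) s" for s
  proof -
    have "?Q * q powi ((s + - 1) * (s + - 1) + (s + - 1)) = q powi (s * s + (int n + 1 - s))"
      by (rule powi_mult) (simp add: algebra_simps)
    also have "\<dots> = q powi (s * s) * q powi (int n + 1 - s)"
      by (rule powi_mult[OF refl, symmetric])
    finally show ?thesis
      unfolding gbin_pascal' by (simp add: algebra_simps)
  qed
  ultimately show A': "((\<lambda>s. q powi (s * s) * gbin q (Suc n) s) has_sum a') UNIV"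
    by simp
  \<comment> \<open>Absorption rewrites (1 - q^(n+1)) [n, s] as (1 - q^(n+1-s)) [n+1, s]; the terms
    with q^(n+1) then cancel.\<close>
  have "q powi (s * s + s) * gbin q (Suc n) s =
      ?Q * (q powi (s * s) * gbin q (Suc n) s) + (1 - ?Q) * (q powi (s * s + s) * gbin q n s)" for s
  proof -
    have 1: "q powi (s * s + s) * q powi (int n + 1 - s) = ?Q * q powi (s * s)"
      unfolding powi_mult[OF refl] by (rule arg_cong[where f = "power_int q"]) simp
    have "?Q * (q powi (s * s) * gbin q (Suc n) s) + (1 - ?Q) * (q powi (s * s + s) * gbin q n s) =
       ?Q * q powi (s * s) * gbin q (Suc n) s + q powi (s * s + s) * ((1 - ?Q) * gbin q n s)"
      by (simp add: algebra_simps)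
    also have "\<dots> = (?Q * q powi (s * s) + q powi (s * s + s) * (1 - q powi (int n + 1 - s))) * gbin q (Suc n) s"
      unfolding gbin_absorb by (simp add: algebra_simps)
    also have "?Q * q powi (s * s) + q powi (s * s + s) * (1 - q powi (int n + 1 - s)) = q powi (s * s + s)"
      unfolding 1[symmetric] by (simp add: algebra_simps)
    finally show ?thesis ..
  qed
  moreover have "((\<lambda>s. ?Q * (q powi (s * s) * gbin q (Suc n) s) + (1 - ?Q) * (q powi (s * s + s) * gbin q n s))
      has_sum (?Q * a' + (1 - ?Q) * b)) UNIV"
    by (intro has_sum_add has_sum_cmult_right A' B)
  ultimately show "((\<lambda>s. q powi (s * s + s) * gbin q (Suc n) s) has_sum (?Q * a' + (1 - ?Q) * b)) UNIV"
    by simp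
qed

text \<open>Both new summands are expanded by Pascal's rules. After reflecting some of the pieces,
  every piece is an old summand, part of the companion, or antisymmetric.\<close>

lemma bressoud_step:
  assumes A: "((\<lambda>j. par j * q powi (2 * (j * j) + tri j) * gbin q (2 * n) (int n + 2 * j)) has_sum a) UNIV"
    and B: "((\<lambda>j. par j * q powi (2 * (j * j) + j + tri j) * gbin q (Suc (2 * n)) (int n + 1 + 2 * j)) has_sum b) UNIV"
  defines "a' \<equiv> a + q powi (int n + 1) * b"
  shows "((\<lambda>j. par j * q powi (2 * (j * j) + tri j) * gbin q (2 * Suc n) (int (Suc n) + 2 * j)) has_sum a') UNIV"
    (is "(?F' has_sum _) _")
    and "((\<lambda>j. par j * q powi (2 * (j * j) + j + tri j) * gbin q (Suc (2 * Suc n)) (int (Suc n) + 1 + 2 * j)) has_sum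
            (q powi (int n + 1) * a' + (1 - q powi (int n + 1)) * b)) UNIV"
    (is "(?H' has_sum _) _")
proof -
  let ?Q = "q powi (int n + 1)"
  define F where "F j = par j * q powi (2 * (j * j) + tri j) * gbin q (2 * n) (int n + 2 * j)" for j
  define H where "H j = par j * q powi (2 * (j * j) + j + tri j) * gbin q (Suc (2 * n)) (int n + 1 + 2 * j)" for j
  \<comment> \<open>Beside \<open>F\<close>, the double Pascal expansion yields \<open>U j\<close>
    (lower neighbour), \<open>X j\<close> (upper neighbour) and \<open>W (- j)\<close> (middle term
    with q^(2n+1)). \<open>W\<close> is stated at the reflected index so that it matches the
    companion in \<open>HU\<close>.\<close>
  define U where "U j = par j * q powi (int n + 1 - 2 * j + 2 * (j * j) + tri j) * gbin q (2 * n) (int n + 2 * j - 1)" for j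
  define W where "W j = par j * q powi (2 * int n + 1 - j + 2 * (j * j) + tri j) * gbin q (2 * n) (int n + 2 * j)" for j
  define X where "X j = par j * q powi (int n + 1 + 2 * j + 2 * (j * j) + tri j) * gbin q (2 * n) (int n + 1 + 2 * j)" for j
  have supp: "gbin q (2 * n) (int n + 2 * j - 1) = 0" "gbin q (2 * n) (int n + 2 * j) = 0"
    "gbin q (2 * n) (int n + 1 + 2 * j) = 0" if "\<bar>j\<bar> > int n + 1" for j
    by (rule gbin_outside, use that in arith)+
  \<comment> \<open>Only the existence of the three sums matters: \<open>x\<close> turns out to be
    0, and \<open>u + w\<close> is identified through \<open>b\<close>.\<close>
  obtain u where u: "(U has_sum u) UNIV"
    by (rule finite_support_has_sum[of "int n + 1" U]) (simp_all add: U_def supp)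
  obtain w where w: "(W has_sum w) UNIV"
    by (rule finite_support_has_sum[of "int n + 1" W]) (simp_all add: W_def supp)
  obtain x where x: "(X has_sum x) UNIV"
    by (rule finite_support_has_sum[of "int n + 1" X]) (simp_all add: X_def supp)
  have FU: "?F' j = F j + U j + (X j + W (- j))" for j
  proof -
    let ?e = "2 * (j * j) + tri j"
    note g = gbin_pascal_twice[of n "2 * j"]
    have e1: "q powi ?e * q powi (int n + 1 - 2 * j) = q powi (int n + 1 - 2 * j + 2 * (j * j) + tri j)"
      by (rule powi_mult) simp
    have e2: "q powi ?e * q powi (int n + 1 + 2 * j) = q powi (int n + 1 + 2 * j + 2 * (j * j) + tri j)"
      by (rule powi_mult) simp
    have e3: "q powi (int n + 1 + 2 * j + 2 * (j * j) + tri j) * q powi (int n - 2 * j)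
       = q powi (2 * int n + 1 + 2 * (j * j) + tri j)"
      by (rule powi_mult) simp
    have "gbin q (2 * n) (int n + 2 * - j) = gbin q (2 * n) (int n + 2 * j)"
      by (rule gbin_symmetric) simp
    then have Wm: "W (- j) = par j * q powi (2 * int n + 1 + 2 * (j * j) + tri j) * gbin q (2 * n) (int n + 2 * j)"
      unfolding W_def by (simp add: tri_uminus par_uminus algebra_simps)
    show ?thesis
      unfolding g F_def U_def X_def Wm e1[symmetric] e3[symmetric] e2[symmetric]
      by (simp add: algebra_simps)
  qed
  \<comment> \<open>One Pascal step splits the companion summand into the same two pieces, so the
    total of \<open>U\<close> and \<open>W\<close> is \<open>?Q * b\<close>.\<close>
  have HU: "?Q * H j = U (- j) + W j" for j
  proof -
    have g: "gbin q (Suc (2 * n)) (int n + 1 + 2 * j) =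
       q powi (int n - 2 * j) * gbin q (2 * n) (int n + 2 * j) + gbin q (2 * n) (int n + 1 + 2 * j)"
      using gbin_pascal'[of "2 * n" "int n + 1 + 2 * j"] by (simp add: algebra_simps)
    have e1: "?Q * q powi (2 * (j * j) + j + tri j) = q powi (int n + 1 + 2 * (j * j) + j + tri j)"
      by (rule powi_mult) simp
    have e2: "q powi (int n + 1 + 2 * (j * j) + j + tri j) * q powi (int n - 2 * j) =
        q powi (2 * int n + 1 - j + 2 * (j * j) + tri j)"
      by (rule powi_mult) simp
    have "gbin q (2 * n) (int n + 2 * - j - 1) = gbin q (2 * n) (int n + 1 + 2 * j)"
      by (rule gbin_symmetric) simp
    then have Um: "U (- j) = par j * q powi (int n + 1 + 2 * (j * j) + j + tri j) * gbin q (2 * n) (int n + 1 + 2 * j)"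
      unfolding U_def by (simp add: tri_uminus par_uminus algebra_simps)
    show ?thesis
      unfolding g H_def W_def Um e2[symmetric] e1[symmetric] by (simp add: algebra_simps)
  qed
  \<comment> \<open>\<open>j \<mapsto> - 1 - j\<close> reverses the sign of \<open>X\<close>, so its sum vanishes.\<close>
  have Xm: "X (- 1 - j) = - X j" for j
  proof -
    have "gbin q (2 * n) (int n + 1 + 2 * (- 1 - j)) = gbin q (2 * n) (int n + 1 + 2 * j)"
      by (rule gbin_symmetric) simp
    then show ?thesis
      unfolding X_def par_reflect tri_reflect
      by (simp add: algebra_simps)
  qed
  have "((\<lambda>j. - X j) has_sum x) UNIV"
    using x has_sum_int_reflect[of X "- 1" x] by (simp add: Xm)
  moreover have "((\<lambda>j. - X j) has_sum - x) UNIV"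
    using x by (simp add: has_sum_uminus)
  ultimately have "x = - x"
    by (rule has_sum_unique)
  then have x0: "x = 0"
    by simp
  have "((\<lambda>j. U (- j) + W j) has_sum (u + w)) UNIV"
    by (intro has_sum_add w) (use u in \<open>simp add: has_sum_int_uminus\<close>)
  moreover have "((\<lambda>j. ?Q * H j) has_sum ?Q * b) UNIV"
    unfolding H_def by (rule has_sum_cmult_right[OF B])
  ultimately have uw: "?Q * b = u + w"
    unfolding HU by (metis has_sum_unique)
  have "((\<lambda>j. F j + U j + (X j + W (- j))) has_sum (a + u + (x + w))) UNIV"
    by (intro has_sum_add u x) (use A w in \<open>simp_all add: has_sum_int_uminus F_def\<close>)
  also have "a + u + (x + w) = a'"
    by (simp add: x0 a'_def uw)
  finally show A': "(?F' has_sum a') UNIV"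
    unfolding FU .
  \<comment> \<open>The remaining piece of the new companion after two Pascal steps. It is
    \<open>H\<close> reflected by \<open>- 1 - j\<close> with opposite sign, so it contributes
    \<open>- b\<close>.\<close>
  define Z where "Z j = par j * q powi (2 * (j * j) + 3 * j + 1 + tri j) * gbin q (Suc (2 * n)) (int n + 2 + 2 * j)" for j
  have HF: "?H' j = ?Q * ?F' (- j) + (H j + ?Q * Z j)" for j
  proof -
    let ?e = "2 * (j * j) + j + tri j"
    have "gbin q (Suc (2 * Suc n)) (int (Suc n) + 1 + 2 * j) =
       q powi (int n + 1 - 2 * j) * gbin q (2 * Suc n) (int n + 1 + 2 * j) + gbin q (2 * Suc n) (int n + 2 + 2 * j)"
      using gbin_pascal'[of "2 * Suc n" "int n + 2 + 2 * j"] by (simp add: algebra_simps)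
    also have "gbin q (2 * Suc n) (int n + 2 + 2 * j) =
       gbin q (Suc (2 * n)) (int n + 1 + 2 * j) + q powi (int n + 2 + 2 * j) * gbin q (Suc (2 * n)) (int n + 2 + 2 * j)"
      using gbin_pascal[of "Suc (2 * n)" "int n + 2 + 2 * j"] by (simp add: algebra_simps)
    finally have g: "gbin q (Suc (2 * Suc n)) (int (Suc n) + 1 + 2 * j) =
       q powi (int n + 1 - 2 * j) * gbin q (2 * Suc n) (int n + 1 + 2 * j) +
       (gbin q (Suc (2 * n)) (int n + 1 + 2 * j) + q powi (int n + 2 + 2 * j) * gbin q (Suc (2 * n)) (int n + 2 + 2 * j))" .
    have e1: "q powi ?e * q powi (int n + 1 - 2 * j) = ?Q * q powi (2 * (j * j) + tri j - j)"
      unfolding powi_mult[OF refl] by (rule arg_cong[where f = "power_int q"]) simp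
    have e2: "q powi ?e * q powi (int n + 2 + 2 * j) = ?Q * q powi (2 * (j * j) + 3 * j + 1 + tri j)"
      unfolding powi_mult[OF refl] by (rule arg_cong[where f = "power_int q"]) simp
    have "gbin q (2 * Suc n) (int (Suc n) + 2 * - j) = gbin q (2 * Suc n) (int n + 1 + 2 * j)"
      by (rule gbin_symmetric) simp
    then have Fm: "?F' (- j) = par j * q powi (2 * (j * j) + tri j - j) * gbin q (2 * Suc n) (int n + 1 + 2 * j)"
      by (simp only: par_uminus tri_uminus) (simp add: algebra_simps)
    have "?H' j = par j * (q powi ?e * q powi (int n + 1 - 2 * j)) * gbin q (2 * Suc n) (int n + 1 + 2 * j)
       + par j * q powi ?e * gbin q (Suc (2 * n)) (int n + 1 + 2 * j)
       + par j * (q powi ?e * q powi (int n + 2 + 2 * j)) * gbin q (Suc (2 * n)) (int n + 2 + 2 * j)"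
      unfolding g by (simp add: algebra_simps)
    also have "\<dots> = ?Q * ?F' (- j) + (H j + ?Q * Z j)"
      unfolding e1 e2 Fm H_def Z_def by (simp add: algebra_simps)
    finally show ?thesis .
  qed
  have "Z j = - H (- 1 - j)" for j
  proof -
    have "gbin q (Suc (2 * n)) (int n + 1 + 2 * (- 1 - j)) = gbin q (Suc (2 * n)) (int n + 2 + 2 * j)"
      by (rule gbin_symmetric) simp
    moreover have "2 * ((- 1 - j) * (- 1 - j)) + (- 1 - j) + tri j = 2 * (j * j) + 3 * j + 1 + tri j"
      by (simp add: algebra_simps)
    ultimately show ?thesis
      unfolding Z_def H_def par_reflect tri_reflect by (simp only: mult_minus_left minus_minus)
  qed
  then have ZH: "Z = (\<lambda>j. - H (- 1 - j))"
    by auto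
  have HB: "(H has_sum b) UNIV"
    unfolding H_def by (rule B)
  then have ZB: "(Z has_sum - b) UNIV"
    unfolding ZH using has_sum_int_reflect[of H "- 1" b] by (simp add: has_sum_uminus)
  have "((\<lambda>j. ?F' (- j)) has_sum a') UNIV"
    using A' by (subst has_sum_int_uminus[where f = ?F'])
  then have "((\<lambda>j. ?Q * ?F' (- j) + (H j + ?Q * Z j)) has_sum (?Q * a' + (b + ?Q * (- b)))) UNIV"
    by (intro has_sum_add has_sum_cmult_right HB ZB)
  also have "?Q * a' + (b + ?Q * (- b)) = ?Q * a' + (1 - ?Q) * b"
    by (simp add: algebra_simps)
  finally show "(?H' has_sum (?Q * a' + (1 - ?Q) * b)) UNIV"
    unfolding HF .
qed

lemma bressoud_finite_rogers_ramanujan: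
  obtains a where
    "((\<lambda>s. q powi (s * s) * gbin q n s) has_sum a) UNIV"
    "((\<lambda>j. par j * q powi (2 * (j * j) + tri j) * gbin q (2 * n) (int n + 2 * j)) has_sum a) UNIV"
proof -
  \<comment> \<open>The recursion couples each sum with its companion, so the induction carries all
    four. Both sides start from the values 1 and 1 at \<open>n = 0\<close>.\<close>
  have "\<exists>a b. ((\<lambda>s. q powi (s * s) * gbin q n s) has_sum a) UNIV \<and>
      ((\<lambda>s. q powi (s * s + s) * gbin q n s) has_sum b) UNIV \<and>
      ((\<lambda>j. par j * q powi (2 * (j * j) + tri j) * gbin q (2 * n) (int n + 2 * j)) has_sum a) UNIV \<and>
      ((\<lambda>j. par j * q powi (2 * (j * j) + j + tri j) * gbin q (Suc (2 * n)) (int n + 1 + 2 * j)) has_sum b) UNIV"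
  proof (induction n)
    case 0
    have g0: "gbin q 0 s = (if s = 0 then 1 else 0)" for s
      using gbin_outside[of s 0 q] gbin_def[of q 0 0] by (cases "s = 0") (auto simp: neq_iff rq_0 qpoch_def)
    have g1: "gbin q (Suc 0) s = (if s = 0 \<or> s = 1 then 1 else 0)" for s
      using gbin_pascal[of 0 s] by (auto simp: g0)
    have single: "(f has_sum f 0) UNIV" if "\<And>s. s \<noteq> 0 \<Longrightarrow> f s = 0" for f :: "int \<Rightarrow> complex"
      by (rule has_sum_finite_neutralI[where B = "{0}"]) (use that in auto)
    have s: "((\<lambda>s. q powi (s * s) * gbin q 0 s) has_sum 1) UNIV"
      "((\<lambda>s. q powi (s * s + s) * gbin q 0 s) has_sum 1) UNIV"
      "((\<lambda>j. par j * q powi (2 * (j * j) + tri j) * gbin q (2 * 0) (int 0 + 2 * j)) has_sum 1) UNIV"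
      using single[of "\<lambda>s. q powi (s * s) * gbin q 0 s"]
        single[of "\<lambda>s. q powi (s * s + s) * gbin q 0 s"]
        single[of "\<lambda>j. par j * q powi (2 * (j * j) + tri j) * gbin q (2 * 0) (int 0 + 2 * j)"]
      by (simp_all add: g0 par_def tri_def)
    have "gbin q (Suc (2 * 0)) (int 0 + 1 + 2 * j) = 0" if "j \<noteq> 0" for j
      using that unfolding mult_0_right g1 by auto
    then have "((\<lambda>j. par j * q powi (2 * (j * j) + j + tri j) * gbin q (Suc (2 * 0)) (int 0 + 1 + 2 * j)) has_sum 1) UNIV"
      using single[of "\<lambda>j. par j * q powi (2 * (j * j) + j + tri j) * gbin q (Suc (2 * 0)) (int 0 + 1 + 2 * j)"]
      by (simp add: g1 par_def tri_def)
    with s show ?case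
      by blast
  next
    case (Suc n)
    then obtain a b where IH: "((\<lambda>s. q powi (s * s) * gbin q n s) has_sum a) UNIV"
      "((\<lambda>s. q powi (s * s + s) * gbin q n s) has_sum b) UNIV"
      "((\<lambda>j. par j * q powi (2 * (j * j) + tri j) * gbin q (2 * n) (int n + 2 * j)) has_sum a) UNIV"
      "((\<lambda>j. par j * q powi (2 * (j * j) + j + tri j) * gbin q (Suc (2 * n)) (int n + 1 + 2 * j)) has_sum b) UNIV"
      by blast
    show ?case
      using rogers_szego_step[OF IH(1,2)] bressoud_step[OF IH(3,4)] by blast
  qed
  with that show ?thesis
    by blast
qed

end

section \<open>Limits and the Jacobi triple product\<close>

text \<open>Outside a finite set \<open>F\<close> the tail of every \<open>f n\<close> is bounded by
  the tail of \<open>h\<close>, uniformly in \<open>n\<close>. Letting \<open>n\<close> grow for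
  fixed \<open>F\<close> bounds the error of \<open>sum g F\<close> by that tail, which tends to 0
  as \<open>F\<close> exhausts \<open>A\<close>.\<close>

lemma has_sum_dominated_convergence:
  fixes f :: "nat \<Rightarrow> 'a \<Rightarrow> 'b :: real_normed_vector"
  assumes sums: "\<And>n. (f n has_sum s n) A"
    and pointwise: "\<And>x. x \<in> A \<Longrightarrow> (\<lambda>n. f n x) \<longlonglongrightarrow> g x"
    and limit: "s \<longlonglongrightarrow> t"
    and bound: "\<And>n x. x \<in> A \<Longrightarrow> norm (f n x) \<le> h x"
    and h: "h summable_on A"
  shows "(g has_sum t) A"
proof -
  have H: "(h has_sum infsum h A) A"
    using h by simp
  have "norm (sum g F - t) \<le> infsum h A - sum h F" if F: "finite F" "F \<subseteq> A" for F
  proof (rule Lim_bounded[where M = 0])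
    show "(\<lambda>n. norm (sum (f n) F - s n)) \<longlonglongrightarrow> norm (sum g F - t)"
      by (intro tendsto_intros limit pointwise) (use F in auto)
    show "\<forall>n\<ge>0. norm (sum (f n) F - s n) \<le> infsum h A - sum h F"
    proof (intro allI impI)
      fix n
      have "(f n has_sum (s n - sum (f n) F)) (A - F)"
        by (rule has_sum_Diff[OF sums has_sum_finite]) (use F in auto)
      moreover have hF: "(h has_sum (infsum h A - sum h F)) (A - F)"
        by (rule has_sum_Diff[OF H has_sum_finite]) (use F in auto)
      moreover have nF: "(\<lambda>x. norm (f n x)) summable_on (A - F)"
        by (rule Infinite_Sum.abs_summable_on_comparison_test'[where g = h])
          (use hF bound in \<open>auto simp: has_sum_imp_summable\<close>)
      ultimately have "norm (s n - sum (f n) F) \<le> infsum (\<lambda>x. norm (f n x)) (A - F)"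
        by (intro norm_has_sum_bound[where f = "f n"]) auto
      also have "\<dots> \<le> infsum h A - sum h F"
        by (rule has_sum_mono[OF has_sum_infsum[OF nF] hF]) (use bound in auto)
      finally show "norm (sum (f n) F - s n) \<le> infsum h A - sum h F"
        by (simp add: norm_minus_commute)
    qed
  qed
  then have "\<forall>\<^sub>F F in finite_subsets_at_top A. norm (sum g F - t) \<le> infsum h A - sum h F"
    by (intro eventually_finite_subsets_at_top_weakI)
  moreover have "((\<lambda>F. infsum h A - sum h F) \<longlongrightarrow> infsum h A - infsum h A) (finite_subsets_at_top A)"
    using H unfolding has_sum_def by (intro tendsto_intros)
  ultimately have "((\<lambda>F. sum g F - t) \<longlongrightarrow> 0) (finite_subsets_at_top A)"
    by (simp add: Lim_null_comparison)
  then show ?thesis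
    unfolding has_sum_def by (simp add: LIM_zero_iff)
qed

lemma summable_on_int:
  fixes f :: "int \<Rightarrow> real"
  assumes "\<And>j. f j \<ge> 0" "summable (\<lambda>n. f (int n))" "summable (\<lambda>n. f (- int n))"
  shows "f summable_on UNIV"
proof -
  have "f summable_on range int"
    using assms by (subst summable_on_reindex) (auto simp: summable_on_UNIV_nonneg_real_iff o_def)
  moreover have "f summable_on range (\<lambda>n. - int n)"
    using assms by (subst summable_on_reindex) (auto simp: summable_on_UNIV_nonneg_real_iff o_def inj_on_def)
  ultimately have "f summable_on (range int \<union> range (\<lambda>n. - int n))"
    by (rule summable_on_union)
  also have "range int \<union> range (\<lambda>n. - int n) = UNIV"
    by (auto simp: image_iff) (metis int_cases2)
  finally show ?thesis .
qed

lemma summable_on_power_nat_abs: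
  fixes x :: real
  assumes "0 \<le> x" "x < 1"
  shows "(\<lambda>j. x ^ nat \<bar>j\<bar>) summable_on UNIV"
  by (rule summable_on_int) (use assms in \<open>auto intro!: summable_geometric\<close>)

text \<open>The ratio of consecutive terms tends to 0 however large \<open>K\<close> is. This fits
  theta series, where \<open>K\<close> depends on an arbitrary nonzero argument.\<close>

lemma summable_ratio_geometric:
  fixes f :: "nat \<Rightarrow> real"
  assumes "\<And>n. f (Suc n) = K * x ^ n * f n" "0 \<le> x" "x < 1"
  shows "summable f"
proof -
  have "(\<lambda>n. norm (K * x ^ n)) \<longlonglongrightarrow> norm (K * 0)"
    by (intro tendsto_intros LIMSEQ_realpow_zero assms)
  then have "\<forall>\<^sub>F n in sequentially. norm (K * x ^ n) < 1 / 2"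
    by (rule order_tendstoD) simp
  then obtain N where N: "\<And>n. n \<ge> N \<Longrightarrow> norm (K * x ^ n) < 1 / 2"
    by (auto simp: eventually_at_top_linorder)
  show ?thesis
  proof (rule summable_ratio_test[where c = "1 / 2" and N = N])
    fix n assume "n \<ge> N"
    then show "norm (f (Suc n)) \<le> 1 / 2 * norm (f n)"
      using N[of n] unfolding assms(1) norm_mult[of "K * x ^ n"]
      by (intro mult_right_mono) auto
  qed simp
qed

section \<open>Limits and bounds for q-Pochhammer symbols\<close>

context
  fixes q :: complex
  assumes q1: "norm q < 1"
begin

lemma qpoch_tendsto: "(\<lambda>n. qpoch a q n) \<longlonglongrightarrow> qpoch_inf a q"
  using has_prod_imp_tendsto'[OF qpoch_inf_has_prod[OF q1]] by (simp add: qpoch_def)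

lemma qpoch_inf_nonzero: "qpoch_inf q q \<noteq> 0"
  using has_prod_eq_0_iff[OF qpoch_inf_has_prod[OF q1, of q]] one_minus_power_nonzero[OF q1]
  by auto

lemma qpoch_bounded: "\<exists>C>0. \<forall>n. norm (qpoch q q n) \<le> C"
  using convergent_imp_Bseq[OF convergentI[OF qpoch_tendsto[of q]]] by (simp add: Bseq_def)

text \<open>The reciprocals converge because the infinite product is nonzero. The uniform constant
  serves every domination argument below.\<close>

lemma rq_bounded: "\<exists>C>0. \<forall>i. norm (rq q i) \<le> C"
proof -
  have "(\<lambda>n. 1 / qpoch q q n) \<longlonglongrightarrow> 1 / qpoch_inf q q"
    by (intro tendsto_intros qpoch_tendsto qpoch_inf_nonzero)
  then have "Bseq (\<lambda>n. 1 / qpoch q q n)"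
    by (intro convergent_imp_Bseq convergentI)
  then obtain C where "C > 0" "\<And>n. norm (1 / qpoch q q n) \<le> C"
    by (auto simp only: Bseq_def)
  then show ?thesis
    by (intro exI[of _ C]) (auto simp: rq_def)
qed

lemma rq_tendsto: "(\<lambda>n. rq q (int n + c)) \<longlonglongrightarrow> 1 / qpoch_inf q q"
proof -
  have "(\<lambda>n. 1 / qpoch q q n) \<longlonglongrightarrow> 1 / qpoch_inf q q"
    by (intro tendsto_intros qpoch_tendsto qpoch_inf_nonzero)
  moreover have "filterlim (\<lambda>n. nat (int n + c)) at_top sequentially"
    unfolding filterlim_at_top
  proof
    fix Z
    show "\<forall>\<^sub>F n in sequentially. Z \<le> nat (int n + c)"
      using eventually_ge_at_top[of "Z + nat \<bar>c\<bar>"] by eventually_elim linarith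
  qed
  ultimately have "(\<lambda>n. 1 / qpoch q q (nat (int n + c))) \<longlonglongrightarrow> 1 / qpoch_inf q q"
    by (rule filterlim_compose)
  moreover have "\<forall>\<^sub>F n in sequentially. 1 / qpoch q q (nat (int n + c)) = rq q (int n + c)"
    using eventually_ge_at_top[of "nat \<bar>c\<bar>"] by eventually_elim (auto simp: rq_def)
  ultimately show ?thesis
    by (rule Lim_transform_eventually)
qed

end

section \<open>The Jacobi triple product\<close>

context
  fixes q :: complex
  assumes q0: "q \<noteq> 0" and q1: "norm q < 1"
begin

text \<open>The finite triple product follows by induction on \<open>n\<close>: multiplying by the
  two new factors combines three neighbouring coefficients exactly as in
  \<open>gbin_pascal_twice\<close>.\<close>

lemma jacobi_triple_product_finite:
  assumes w: "w \<noteq> 0"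
  shows "((\<lambda>j. par j * q powi tri (j - 1) * w powi j * gbin q (2 * n) (int n + j)) has_sum
           qpoch w q n * qpoch (q / w) q n) UNIV"
proof (induction n)
  case 0
  have "gbin q 0 j = 0" if "j \<noteq> 0" for j
    using that by (intro gbin_outside) auto
  moreover have "gbin q 0 0 = 1"
    by (simp add: gbin_def rq_0 qpoch_def)
  ultimately show ?case
    by (intro has_sum_finite_neutralI[where B = "{0}"]) (auto simp: par_def tri_def qpoch_def)
next
  case (Suc n)
  define J where "J j = par j * q powi tri (j - 1) * w powi j * gbin q (2 * n) (int n + j)" for j
  define P where "P = qpoch w q n * qpoch (q / w) q n"
  \<comment> \<open>Coefficients of the expanded factor (1 - w q^n)(1 - q^(n+1)/w). Multiplication
    by \<open>w\<close> or \<open>1 / w\<close> shifts the index \<open>j\<close>.\<close>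
  let ?a = "- (w * q powi int n)" and ?b = "- (q powi (int n + 1) / w)" and ?c = "1 + q powi (2 * int n + 1)"
  have J: "(J has_sum P) UNIV"
    unfolding J_def P_def by (rule Suc.IH)
  have "((\<lambda>j. ?c * J j + (?a * J (j + - 1) + ?b * J (j + 1))) has_sum (?c * P + (?a * P + ?b * P))) UNIV"
    by (intro has_sum_add has_sum_cmult_right has_sum_int_shift[THEN iffD2] J)
  moreover have "?c * P + (?a * P + ?b * P) = qpoch w q (Suc n) * qpoch (q / w) q (Suc n)"
  proof -
    have "q powi (2 * int n + 1) = q * q ^ n * q ^ n" "q powi (int n + 1) = q * q ^ n"
      using power_int_of_nat[of q "Suc (n + n)"] power_int_of_nat[of q "Suc n"]
      by (simp_all add: power_add add.commute)
    then show ?thesis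
      unfolding P_def using w by (simp add: qpoch_Suc field_simps)
  qed
  moreover have "?c * J j + (?a * J (j + - 1) + ?b * J (j + 1)) =
      par j * q powi tri (j - 1) * w powi j * gbin q (2 * Suc n) (int (Suc n) + j)" for j
  proof -
    let ?t = "q powi tri (j - 1)"
    have e1: "q powi int n * q powi tri (j - 1 - 1) = ?t * q powi (int n + 1 - j)"
      unfolding powi_mult[OF q0 q1 refl] by (rule arg_cong[where f = "power_int q"]) (use tri_diff1[of "j - 1"] in simp)
    have e2: "q powi (int n + 1) * q powi tri j = ?t * q powi (int n + 1 + j)"
      unfolding powi_mult[OF q0 q1 refl] by (rule arg_cong[where f = "power_int q"]) (simp add: tri_diff1)
    have e3: "q powi (2 * int n + 1) = q powi (int n + 1 + j) * q powi (int n - j)"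
      unfolding powi_mult[OF q0 q1 refl] by (rule arg_cong[where f = "power_int q"]) simp
    have w1: "w * w powi (j - 1) = w powi j"
      using w by (simp add: power_int_diff)
    have w2: "w powi (j + 1) = w * w powi j"
      using w by (simp add: power_int_add)
    have "?a * J (j + - 1) = par j * (q powi int n * q powi tri (j - 1 - 1)) * (w * w powi (j - 1)) * gbin q (2 * n) (int n + j - 1)"
      unfolding J_def by (simp add: par_diff1 algebra_simps)
    moreover have "?b * J (j + 1) = par j * (q powi (int n + 1) * q powi tri j) * w powi j * gbin q (2 * n) (int n + 1 + j)"
      unfolding J_def w2 par_add1 using w by (simp add: algebra_simps)
    ultimately show ?thesis
      unfolding gbin_pascal_twice[OF q0 q1] e1 e2 e3 w1 J_def by (simp add: algebra_simps)
  qed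
  ultimately show ?case
    by simp
qed

lemma theta_summable:
  assumes w: "w \<noteq> 0"
  shows "(\<lambda>j. norm (q powi tri (j - 1) * w powi j)) summable_on UNIV"
proof (rule summable_on_int)
  show "summable (\<lambda>n. norm (q powi tri (int n - 1) * w powi int n))"
  proof (rule summable_ratio_geometric)
    fix n
    have "tri (int (Suc n) - 1) = int n + tri (int n - 1)"
      using tri_diff1[of "int n"] by simp
    then have "q powi tri (int (Suc n) - 1) = q powi int n * q powi tri (int n - 1)"
      by (simp only: powi_mult[OF q0 q1 refl])
    then show "norm (q powi tri (int (Suc n) - 1) * w powi int (Suc n)) =
        norm w * norm q ^ n * norm (q powi tri (int n - 1) * w powi int n)"
      unfolding power_int_of_nat by (simp add: norm_mult norm_power algebra_simps)
  qed (use q1 in auto)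
  show "summable (\<lambda>n. norm (q powi tri (- int n - 1) * w powi (- int n)))"
  proof (rule summable_ratio_geometric)
    fix n
    have t: "tri (- int m - 1) = tri (int m)" for m
      using tri_reflect[of "int m"] by (simp only: diff_conv_add_uminus add.commute)
    have "tri (int (Suc n)) = int (Suc n) + tri (int n)"
      using tri_add1[of "int n"] by (simp add: add.commute)
    then have "q powi tri (int (Suc n)) = q powi int (Suc n) * q powi tri (int n)"
      by (simp only: powi_mult[OF q0 q1 refl])
    then show "norm (q powi tri (- int (Suc n) - 1) * w powi (- int (Suc n))) =
        (norm q / norm w) * norm q ^ n * norm (q powi tri (- int n - 1) * w powi (- int n))"
      unfolding t power_int_of_nat power_int_minus
      by (simp add: norm_mult norm_power norm_inverse divide_inverse algebra_simps)
  qed (use q1 in auto)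
qed auto

lemma jacobi_triple_product:
  assumes w: "w \<noteq> 0"
  shows "((\<lambda>j. par j * q powi tri (j - 1) * w powi j / qpoch_inf q q) has_sum
           qpoch_inf w q * qpoch_inf (q / w) q) UNIV"
proof -
  obtain C where C: "C > 0" "\<And>i. norm (rq q i) \<le> C"
    using rq_bounded[OF q1] by blast
  obtain D where D: "D > 0" "\<And>i. norm (qpoch q q i) \<le> D"
    using qpoch_bounded[OF q1] by blast
  define h where "h j = norm (q powi tri (j - 1) * w powi j) * (D * C * C)" for j
  show ?thesis
  proof (rule has_sum_dominated_convergence[where h = h])
    show "((\<lambda>j. par j * q powi tri (j - 1) * w powi j * gbin q (2 * n) (int n + j)) has_sum
           qpoch w q n * qpoch (q / w) q n) UNIV" for n
      by (rule jacobi_triple_product_finite[OF w])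
    show "(\<lambda>n. qpoch w q n * qpoch (q / w) q n) \<longlonglongrightarrow> qpoch_inf w q * qpoch_inf (q / w) q"
      by (intro tendsto_intros qpoch_tendsto q1)
    show "h summable_on UNIV"
      unfolding h_def by (intro summable_on_cmult_left theta_summable w)
    fix j
    have "(\<lambda>n. qpoch q q (2 * n)) \<longlonglongrightarrow> qpoch_inf q q"
      by (rule filterlim_compose[OF qpoch_tendsto[OF q1]]) (auto intro: filterlim_subseq simp: strict_mono_def)
    \<comment> \<open>Central binomials tend to 1/(q)_\<infinity>: one product over two.\<close>
    then have "(\<lambda>n. qpoch q q (2 * n) * rq q (int n + j) * rq q (int n + - j)) \<longlonglongrightarrow>
        qpoch_inf q q * (1 / qpoch_inf q q) * (1 / qpoch_inf q q)"
      by (intro tendsto_mult rq_tendsto q1)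
    then have "(\<lambda>n. gbin q (2 * n) (int n + j)) \<longlonglongrightarrow> 1 / qpoch_inf q q"
      using qpoch_inf_nonzero[OF q1] by (simp add: gbin_def algebra_simps)
    then have "(\<lambda>n. par j * q powi tri (j - 1) * w powi j * gbin q (2 * n) (int n + j)) \<longlonglongrightarrow>
        par j * q powi tri (j - 1) * w powi j * (1 / qpoch_inf q q)"
      by (intro tendsto_intros)
    then show "(\<lambda>n. par j * q powi tri (j - 1) * w powi j * gbin q (2 * n) (int n + j)) \<longlonglongrightarrow>
        par j * q powi tri (j - 1) * w powi j / qpoch_inf q q"
      by simp
    show "norm (par j * q powi tri (j - 1) * w powi j * gbin q (2 * n) (int n + j)) \<le> h j" for n
    proof -
      have "norm (gbin q (2 * n) (int n + j)) \<le> D * C * C"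
        unfolding gbin_def norm_mult using C D by (intro mult_mono) (auto intro: less_imp_le)
      then have "norm (q powi tri (j - 1) * w powi j) * norm (gbin q (2 * n) (int n + j)) \<le> h j"
        unfolding h_def by (rule mult_left_mono) simp
      then show ?thesis
        by (simp add: norm_mult norm_par)
    qed
  qed
qed

section \<open>The q-Vandermonde sum and its limit\<close>

lemma q_vandermonde:
  "((\<lambda>s. q powi (s * s + a * s) * (rq q (int M - s) * rq q s * rq q (s + a))) has_sum
      rq q (int M) * rq q (int M + a)) UNIV"
\<comment> \<open>The step from \<open>M\<close> to \<open>Suc M\<close> uses the hypothesis at both
  \<open>a\<close> and \<open>a + 1\<close>.\<close>
proof (induction M arbitrary: a)
  case 0
  have "rq q (int 0 - s) * rq q s = 0" if "s \<noteq> 0" for s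
    using that by (cases "s < 0") (auto simp: rq_neg)
  then show ?case
    by (intro has_sum_finite_neutralI[where B = "{0}"]) (auto simp: rq_0)
next
  case (Suc M)
  define T where "T M a s = q powi (s * s + a * s) * (rq q (int M - s) * rq q s * rq q (s + a))" for M a s
  let ?Q = "q powi (int M + 1)" and ?R = "q powi (int M + 1 + a)"
  have IH: "(T M a has_sum rq q (int M) * rq q (int M + a)) UNIV" for a
    unfolding T_def by (rule Suc.IH)
  have Q: "1 - ?Q \<noteq> 0"
    using one_minus_power_nonzero[OF q1, of M] q0 by (simp add: power_int_add mult.commute)
  have "((\<lambda>s. T M a s + ?R * T M (a + 1) (s + - 1)) has_sum
      (rq q (int M) * rq q (int M + a) + ?R * (rq q (int M) * rq q (int M + (a + 1))))) UNIV"
    by (intro has_sum_add has_sum_cmult_right IH) (subst has_sum_int_shift[where f = "T M (a + 1)"], rule IH)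
  \<comment> \<open>The split 1 - q^(M+1) = (1 - q^(M+1-s)) + q^(M+1-s) (1 - q^s) is behind this:
    the first part lowers M + 1 - s, the second lowers \<open>s\<close>.\<close>
  moreover have "T M a s + ?R * T M (a + 1) (s + - 1) = (1 - ?Q) * T (Suc M) a s" for s
  proof -
    let ?E = "q powi (s * s + a * s)"
    have r: "rq q (int M - s) = (1 - q powi (int M + 1 - s)) * rq q (int M + 1 - s)"
      using rq_pred[OF q0 q1, of "int M + 1 - s"] by (simp add: algebra_simps)
    have e1: "?R * q powi ((s + - 1) * (s + - 1) + (a + 1) * (s + - 1)) = ?E * q powi (int M + 1 - s)"
      unfolding powi_mult[OF q0 q1 refl] by (rule arg_cong[where f = "power_int q"]) (simp add: algebra_simps)
    have e2: "?Q = q powi (int M + 1 - s) * q powi s"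
      unfolding powi_mult[OF q0 q1 refl] by simp
    have "?R * T M (a + 1) (s + - 1) =
      (?R * q powi ((s + - 1) * (s + - 1) + (a + 1) * (s + - 1))) * (rq q (int M + 1 - s) * rq q (s - 1) * rq q (s + a))"
      unfolding T_def by (simp add: algebra_simps)
    then show ?thesis
      unfolding e1 e2 T_def r rq_pred[OF q0 q1] by (simp add: algebra_simps)
  qed
  moreover have "rq q (int M) * rq q (int M + a) + ?R * (rq q (int M) * rq q (int M + (a + 1))) =
      (1 - ?Q) * (rq q (int (Suc M)) * rq q (int (Suc M) + a))"
  proof -
    have r1: "rq q (int M) = (1 - ?Q) * rq q (int M + 1)"
      using rq_pred[OF q0 q1, of "int M + 1"] by simp
    have r2: "rq q (int M + a) = (1 - ?R) * rq q (int M + 1 + a)"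
      using rq_pred[OF q0 q1, of "int M + 1 + a"] by (simp add: algebra_simps)
    show ?thesis
      unfolding r1 r2 by (simp add: algebra_simps)
  qed
  ultimately have "((\<lambda>s. (1 - ?Q) * T (Suc M) a s) has_sum
      (1 - ?Q) * (rq q (int (Suc M)) * rq q (int (Suc M) + a))) UNIV"
    by simp
  then have "(T (Suc M) a has_sum rq q (int (Suc M)) * rq q (int (Suc M) + a)) UNIV"
    unfolding has_sum_cmult_right_iff[OF Q] using Q by simp
  then show ?case
    unfolding T_def .
qed

lemma q_vandermonde_limit:
  "((\<lambda>s. q powi (s * s + a * s) * (rq q s * rq q (s + a))) has_sum 1 / qpoch_inf q q) UNIV"
proof -
  obtain C where C: "C > 0" "\<And>i. norm (rq q i) \<le> C"
    using rq_bounded[OF q1] by blast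
  let ?p = "qpoch_inf q q"
  \<comment> \<open>Terms with \<open>s < 0\<close> or \<open>s + a < 0\<close> vanish. Elsewhere
    s(s+a) \<ge> s - |a|, which gives a geometric majorant.\<close>
  define h where "h s = norm q powi (- \<bar>a\<bar>) * (C * C * C) * norm q ^ nat \<bar>s\<bar>" for s
  have "((\<lambda>s. q powi (s * s + a * s) * (1 / ?p * rq q s * rq q (s + a))) has_sum (1 / ?p * (1 / ?p))) UNIV"
  proof (rule has_sum_dominated_convergence[where h = h])
    show "((\<lambda>s. q powi (s * s + a * s) * (rq q (int M - s) * rq q s * rq q (s + a))) has_sum
      rq q (int M) * rq q (int M + a)) UNIV" for M
      by (rule q_vandermonde)
    show "(\<lambda>M. rq q (int M) * rq q (int M + a)) \<longlonglongrightarrow> 1 / ?p * (1 / ?p)"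
      using rq_tendsto[OF q1, of 0] by (intro tendsto_mult rq_tendsto q1) simp
    show "h summable_on UNIV"
      unfolding h_def by (intro summable_on_cmult_right summable_on_power_nat_abs) (use q1 in auto)
    fix s
    show "(\<lambda>M. q powi (s * s + a * s) * (rq q (int M - s) * rq q s * rq q (s + a))) \<longlonglongrightarrow>
       q powi (s * s + a * s) * (1 / ?p * rq q s * rq q (s + a))"
      using rq_tendsto[OF q1, of "- s"] by (intro tendsto_intros) simp
    show "norm (q powi (s * s + a * s) * (rq q (int M - s) * rq q s * rq q (s + a))) \<le> h s" for M
    proof (cases "s \<ge> 0 \<and> s + a \<ge> 0")
      case True
      have "s - \<bar>a\<bar> \<le> s * s + a * s"
      proof (cases "s + a = 0")
        case True
        then show ?thesis
          by (simp flip: distrib_right)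
      next
        case False
        then have "s * 1 \<le> s * (s + a)"
          using \<open>s \<ge> 0 \<and> s + a \<ge> 0\<close> by (intro mult_left_mono) auto
        then show ?thesis
          by (simp add: algebra_simps)
      qed
      then have "norm q powi (s * s + a * s) \<le> norm q powi (s - \<bar>a\<bar>)"
        using q0 q1 by (intro power_int_decreasing) auto
      also have "\<dots> = norm q powi (- \<bar>a\<bar>) * norm q ^ nat \<bar>s\<bar>"
        using q0 True by (simp add: power_int_diff power_int_minus divide_inverse power_int_nonneg_exp[of s])
      finally have "norm (q powi (s * s + a * s)) \<le> norm q powi (- \<bar>a\<bar>) * norm q ^ nat \<bar>s\<bar>"
        by (simp add: norm_power_int)
      moreover have "norm (rq q (int M - s) * rq q s * rq q (s + a)) \<le> C * C * C"
        unfolding norm_mult using C by (intro mult_mono) (auto intro: less_imp_le)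
      ultimately have "norm (q powi (s * s + a * s)) * norm (rq q (int M - s) * rq q s * rq q (s + a)) \<le>
          (norm q powi (- \<bar>a\<bar>) * norm q ^ nat \<bar>s\<bar>) * (C * C * C)"
        by (intro mult_mono) auto
      then show ?thesis
        unfolding norm_mult[of "q powi _"] h_def by (simp add: algebra_simps)
    next
      case False
      then have z: "rq q (int M - s) * rq q s * rq q (s + a) = 0"
        by (auto simp: rq_neg)
      have "0 \<le> h s"
        unfolding h_def using C(1) by (intro mult_nonneg_nonneg) auto
      then show ?thesis
        unfolding z by simp
    qed
  qed
  \<comment> \<open>The limit of \<open>rq q (int M - s)\<close> leaves a factor
    \<open>1 / ?p\<close> on both sides, removed here.\<close>
  then have "((\<lambda>s. ?p * (q powi (s * s + a * s) * (1 / ?p * rq q s * rq q (s + a)))) has_sum ?p * (1 / ?p * (1 / ?p))) UNIV"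
    by (rule has_sum_cmult_right)
  then show ?thesis
    using qpoch_inf_nonzero[OF q1] by (simp add: field_simps)
qed

section \<open>Bailey's lemma at \<open>a = 1\<close>\<close>

text \<open>Substitute \<open>k = s + i\<close> in \<open>q_vandermonde\<close> with
  \<open>M = L - i\<close> and \<open>a = 2 * i\<close>; the exponent i^2 + s^2 + 2is becomes k^2.
  One application reproduces the kernel with \<open>L\<close> in place of \<open>k\<close>, at the
  cost of q^(i^2). For \<open>L < i\<close> everything vanishes.\<close>

lemma bailey_lemma_unit:
  "((\<lambda>k. q powi (k * k) * (rq q (L - k) * rq q (k - i) * rq q (k + i))) has_sum
      q powi (i * i) * (rq q (L - i) * rq q (L + i))) UNIV"
    (is "(?f has_sum ?s) _")
proof (cases "L - i \<ge> 0")
  case True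
  then obtain M where M: "L - i = int M"
    by (metis nonneg_int_cases)
  have "((\<lambda>s. q powi (i * i) * (q powi (s * s + 2 * i * s) * (rq q (int M - s) * rq q s * rq q (s + 2 * i)))) has_sum
      q powi (i * i) * (rq q (int M) * rq q (int M + 2 * i))) UNIV"
    by (intro has_sum_cmult_right q_vandermonde)
  moreover have "q powi (i * i) * (q powi (s * s + 2 * i * s) * (rq q (int M - s) * rq q s * rq q (s + 2 * i))) = ?f (s + i)" for s
  proof -
    have "q powi (i * i) * q powi (s * s + 2 * i * s) = q powi ((s + i) * (s + i))"
      by (rule powi_mult[OF q0 q1]) (simp add: algebra_simps)
    then show ?thesis
      using M by (simp add: algebra_simps)
  qed
  moreover have "int M + 2 * i = L + i"
    using M by simp
  ultimately have "((\<lambda>s. ?f (s + i)) has_sum ?s) UNIV"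
    by (simp add: M)
  then show ?thesis
    by (subst (asm) has_sum_int_shift[where f = ?f])
next
  case False
  then have "?f k = 0" for k
    by (cases "k - i < 0"; cases "L - k < 0") (auto simp: rq_neg)
  moreover have "?s = 0"
    using False by (simp add: rq_neg)
  ultimately show ?thesis
    by (simp only: has_sum_0_simp)
qed

lemma bailey_lemma_unit_limit:
  "((\<lambda>L. q powi (L * L) * (rq q (L - i) * rq q (L + i))) has_sum q powi (i * i) / qpoch_inf q q) UNIV"
    (is "(?f has_sum ?s) _")
proof -
  have "((\<lambda>s. q powi (i * i) * (q powi (s * s + 2 * i * s) * (rq q s * rq q (s + 2 * i)))) has_sum
      q powi (i * i) * (1 / qpoch_inf q q)) UNIV"
    by (intro has_sum_cmult_right q_vandermonde_limit)
  moreover have "q powi (i * i) * (q powi (s * s + 2 * i * s) * (rq q s * rq q (s + 2 * i))) = ?f (s + i)" for s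
  proof -
    have "q powi (i * i) * q powi (s * s + 2 * i * s) = q powi ((s + i) * (s + i))"
      by (rule powi_mult[OF q0 q1]) (simp add: algebra_simps)
    then show ?thesis
      by (simp add: algebra_simps)
  qed
  ultimately have "((\<lambda>s. ?f (s + i)) has_sum ?s) UNIV"
    by simp
  then show ?thesis
    by (subst (asm) has_sum_int_shift[where f = ?f])
qed

end

section \<open>The triple sum\<close>

lemma summable_on_times_nonneg:
  fixes f :: "'a \<Rightarrow> real" and g :: "'b \<Rightarrow> real"
  assumes "f summable_on A" "g summable_on B" "\<And>x. f x \<ge> 0" "\<And>y. g y \<ge> 0"
  shows "(\<lambda>(x, y). f x * g y) summable_on A \<times> B"
proof (rule summable_on_SigmaI)
  show "((\<lambda>y. case (x, y) of (x, y) \<Rightarrow> f x * g y) has_sum f x * infsum g B) B" for x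
    using has_sum_cmult_right[OF has_sum_infsum[OF assms(2)]] by simp
  show "(\<lambda>x. f x * infsum g B) summable_on A"
    by (intro summable_on_cmult_left assms)
qed (use assms in auto)

lemma abs_le_square_int: "\<bar>i\<bar> \<le> i * i" for i :: int
proof (cases "i = 0")
  case False
  then have "\<bar>i\<bar> * 1 \<le> \<bar>i\<bar> * \<bar>i\<bar>"
    by (intro mult_left_mono) auto
  then show ?thesis
    by (simp add: abs_mult_self_eq)
qed simp

text \<open>Bressoud's coefficient (-1)^j q^(j(5j+1)/2), attached to the Bailey index 2j.\<close>

definition theta_coeff :: "complex \<Rightarrow> int \<Rightarrow> complex" where
  "theta_coeff q j = par j * q powi (2 * (j * j) + tri j)"

definition inner_term :: "complex \<Rightarrow> int \<Rightarrow> int \<Rightarrow> int \<Rightarrow> complex" where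
  "inner_term q m k j = q powi (k * k + (m + k) * (m + k)) * (rq q m * rq q (k - 2 * j) * rq q (k + 2 * j))"

text \<open>The summand of the theorem extended by 0 to integer indices. \<open>nat k\<close> is
  harmless, because \<open>rq q (2 * k)\<close> vanishes for negative \<open>k\<close>.\<close>

definition triple_term :: "complex \<Rightarrow> int \<Rightarrow> int \<Rightarrow> int \<Rightarrow> complex" where
  "triple_term q m k n = q powi (k * k + (m + k) * (m + k) + n * n) * (rq q m * rq q (2 * k) * gbin q (nat k) n)"

section \<open>Absolute convergence over all integer triples\<close>

context
  fixes q :: complex
  assumes q0: "q \<noteq> 0" and q1: "norm q < 1"
begin

lemma summable_triple_geometric_bound:
  fixes f :: "(int \<times> int) \<times> int \<Rightarrow> complex"
  assumes "\<And>m k j. norm (f ((m, k), j)) \<le> K * (norm q ^ nat \<bar>m\<bar> * norm q ^ nat \<bar>k\<bar> * norm q ^ nat \<bar>j\<bar>)"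
  shows "f summable_on UNIV"
proof -
  let ?x = "\<lambda>i::int. norm q ^ nat \<bar>i\<bar>"
  have x: "?x summable_on UNIV"
    by (rule summable_on_power_nat_abs) (use q1 in auto)
  have "(\<lambda>(p, j). (case p of (m, k) \<Rightarrow> ?x m * ?x k) * ?x j) summable_on (UNIV \<times> UNIV) \<times> UNIV"
    by (intro summable_on_times_nonneg x) auto
  then have "(\<lambda>p. K * (case p of (p, j) \<Rightarrow> (case p of (m, k) \<Rightarrow> ?x m * ?x k) * ?x j)) summable_on UNIV"
    by (intro summable_on_cmult_right) simp
  then have "(\<lambda>p. norm (f p)) summable_on UNIV"
    by (rule Infinite_Sum.abs_summable_on_comparison_test') (use assms in auto)
  then show ?thesis
    by (rule abs_summable_summable)
qed

lemma norm_powi_le: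
  assumes "int n \<le> e"
  shows "norm (q powi e) \<le> norm q ^ n"
  using power_int_decreasing[OF assms, of "norm q"] q0 q1 by (simp add: norm_power_int)

lemma abs_le_pentagonal: "\<bar>j\<bar> \<le> 2 * (j * j) + tri j"
  using abs_le_square_int[of j] two_tri[of j] by arith

lemma summable_inner_theta: "(\<lambda>((m, k), j). theta_coeff q j * inner_term q m k j) summable_on UNIV"
proof -
  obtain C where C: "C > 0" "\<And>i. norm (rq q i) \<le> C"
    using rq_bounded[OF q1] by blast
  show ?thesis
  proof (rule summable_triple_geometric_bound[where K = "C * C * C"])
    fix m k j
    let ?B = "C * C * C * (norm q ^ nat \<bar>m\<bar> * norm q ^ nat \<bar>k\<bar> * norm q ^ nat \<bar>j\<bar>)"
    have B0: "0 \<le> ?B"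
      using C(1) by (intro mult_nonneg_nonneg) auto
    show "norm ((\<lambda>((m, k), j). theta_coeff q j * inner_term q m k j) ((m, k), j)) \<le> ?B"
    proof (cases "m \<ge> 0 \<and> k \<ge> 0")
      case True
      \<comment> \<open>Each square pays for one index: (m+k)^2 for \<open>m\<close>, k^2 for
        \<open>k\<close>, and the pentagonal exponent for \<open>j\<close>.\<close>
      have "m \<le> (m + k) * (m + k)"
        using abs_le_square_int[of "m + k"] True by simp
      then have "norm (q powi (k * k + (m + k) * (m + k))) \<le> norm q ^ (nat \<bar>m\<bar> + nat \<bar>k\<bar>)"
        using abs_le_square_int[of k] True by (intro norm_powi_le) simp
      moreover have "norm (theta_coeff q j) \<le> norm q ^ nat \<bar>j\<bar>"
        unfolding theta_coeff_def norm_mult norm_par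
        using norm_powi_le[of "nat \<bar>j\<bar>" "2 * (j * j) + tri j"] abs_le_pentagonal[of j] by simp
      moreover have "norm (rq q m * rq q (k - 2 * j) * rq q (k + 2 * j)) \<le> C * C * C"
        unfolding norm_mult using C by (intro mult_mono) (auto intro: less_imp_le)
      ultimately have "norm (theta_coeff q j) * (norm (q powi (k * k + (m + k) * (m + k))) *
          norm (rq q m * rq q (k - 2 * j) * rq q (k + 2 * j))) \<le>
          norm q ^ nat \<bar>j\<bar> * (norm q ^ (nat \<bar>m\<bar> + nat \<bar>k\<bar>) * (C * C * C))"
        by (intro mult_mono) auto
      then show ?thesis
        by (simp add: inner_term_def norm_mult power_add mult_ac)
    next
      case False
      then have "m < 0 \<or> k - 2 * j < 0 \<or> k + 2 * j < 0"
        by linarith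
      then have "inner_term q m k j = 0"
        unfolding inner_term_def by (auto simp: rq_neg)
      then show ?thesis
        using B0 by simp
    qed
  qed
qed

lemma summable_triple_term: "(\<lambda>((m, k), n). triple_term q m k n) summable_on UNIV"
proof -
  obtain C where C: "C > 0" "\<And>i. norm (rq q i) \<le> C"
    using rq_bounded[OF q1] by blast
  obtain D where D: "D > 0" "\<And>i. norm (qpoch q q i) \<le> D"
    using qpoch_bounded[OF q1] by blast
  show ?thesis
  proof (rule summable_triple_geometric_bound[where K = "C * C * (D * C * C)"])
    fix m k n
    let ?B = "C * C * (D * C * C) * (norm q ^ nat \<bar>m\<bar> * norm q ^ nat \<bar>k\<bar> * norm q ^ nat \<bar>n\<bar>)"
    have B0: "0 \<le> ?B"
      using C(1) D(1) by (intro mult_nonneg_nonneg) auto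
    show "norm ((\<lambda>((m, k), n). triple_term q m k n) ((m, k), n)) \<le> ?B"
    proof (cases "m \<ge> 0 \<and> k \<ge> 0")
      case True
      have "m \<le> (m + k) * (m + k)"
        using abs_le_square_int[of "m + k"] True by simp
      then have "norm (q powi (k * k + (m + k) * (m + k) + n * n)) \<le> norm q ^ (nat \<bar>m\<bar> + nat \<bar>k\<bar> + nat \<bar>n\<bar>)"
        using abs_le_square_int[of k] abs_le_square_int[of n] True by (intro norm_powi_le) simp
      moreover have "norm (rq q m * rq q (2 * k) * gbin q (nat k) n) \<le> C * C * (D * C * C)"
        unfolding norm_mult gbin_def using C D by (intro mult_mono) (auto intro: less_imp_le)
      ultimately have "norm (q powi (k * k + (m + k) * (m + k) + n * n)) *
          norm (rq q m * rq q (2 * k) * gbin q (nat k) n) \<le>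
          norm q ^ (nat \<bar>m\<bar> + nat \<bar>k\<bar> + nat \<bar>n\<bar>) * (C * C * (D * C * C))"
        by (intro mult_mono) auto
      then show ?thesis
        by (simp add: triple_term_def norm_mult power_add mult_ac)
    next
      case False
      then have "triple_term q m k n = 0"
        unfolding triple_term_def by (auto simp: rq_neg)
      then show ?thesis
        using B0 by simp
    qed
  qed
qed

section \<open>Exchanging the sums and evaluating them\<close>

lemma inner_sums_agree:
  "\<exists>s. ((\<lambda>j. theta_coeff q j * inner_term q m k j) has_sum s) UNIV \<and> ((\<lambda>n. triple_term q m k n) has_sum s) UNIV"
proof (cases "k \<ge> 0")
  case True
  then obtain K where K: "k = int K"
    by (metis nonneg_int_cases)
  obtain a where a: "((\<lambda>s. q powi (s * s) * gbin q K s) has_sum a) UNIV"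
    "((\<lambda>j. par j * q powi (2 * (j * j) + tri j) * gbin q (2 * K) (int K + 2 * j)) has_sum a) UNIV"
    by (rule bressoud_finite_rogers_ramanujan[OF q0 q1])
  define c where "c = q powi (k * k + (m + k) * (m + k)) * rq q m * rq q (2 * k)"
  have one: "rq q (2 * k) * qpoch q q (2 * K) = 1"
    using qpoch_nonzero[OF q1] by (simp add: K rq_def nat_mult_distrib)
  \<comment> \<open>Division by (q)_{2k} turns Bressoud's binomial into the Bailey kernel at index
    2j.\<close>
  have r: "rq q (2 * k) * gbin q (2 * K) (k + 2 * j) = rq q (k - 2 * j) * rq q (k + 2 * j)" for j
  proof -
    have "int (2 * K) - (k + 2 * j) = k - 2 * j"
      by (simp add: K)
    then have "gbin q (2 * K) (k + 2 * j) = qpoch q q (2 * K) * (rq q (k - 2 * j) * rq q (k + 2 * j))"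
      by (simp add: gbin_def mult_ac)
    then have "rq q (2 * k) * gbin q (2 * K) (k + 2 * j) =
        (rq q (2 * k) * qpoch q q (2 * K)) * (rq q (k - 2 * j) * rq q (k + 2 * j))"
      by simp
    then show ?thesis
      unfolding one by simp
  qed
  have "theta_coeff q j * inner_term q m k j = c * (par j * q powi (2 * (j * j) + tri j) * gbin q (2 * K) (int K + 2 * j))" for j
  proof -
    have "theta_coeff q j * inner_term q m k j =
      par j * q powi (2 * (j * j) + tri j) * q powi (k * k + (m + k) * (m + k)) * rq q m * (rq q (k - 2 * j) * rq q (k + 2 * j))"
      unfolding theta_coeff_def inner_term_def by (simp add: mult_ac)
    also have "\<dots> = c * (par j * q powi (2 * (j * j) + tri j) * gbin q (2 * K) (k + 2 * j))"
      unfolding r[symmetric] c_def by (simp only: mult_ac)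
    finally show ?thesis
      by (simp only: K)
  qed
  moreover have "triple_term q m k n = c * (q powi (n * n) * gbin q K n)" for n
    unfolding triple_term_def c_def powi_mult[OF q0 q1 refl, of _ "n * n", symmetric] by (simp add: K mult_ac)
  ultimately show ?thesis
    using has_sum_cmult_right[OF a(1), of c] has_sum_cmult_right[OF a(2), of c] by auto
next
  case False
  then have neg: "k - 2 * j < 0 \<or> k + 2 * j < 0" for j
    by linarith
  have "rq q (k - 2 * j) * rq q (k + 2 * j) = 0" for j
    using neg[of j] by (auto simp: rq_neg)
  then have "inner_term q m k j = 0" for j
    unfolding inner_term_def by (simp add: mult.assoc)
  moreover have "triple_term q m k n = 0" for n
    unfolding triple_term_def using False by (simp add: rq_neg)
  ultimately show ?thesis
    by (intro exI[of _ 0]) simp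
qed

text \<open>With \<open>L = m + k\<close>, the sum over \<open>k\<close> and then the sum over
  \<open>L\<close> each yield q^((2j)^2), hence q^(8j^2) in total. Summability is assumed so that
  the double sum may be evaluated iteratively.\<close>

lemma inner_term_double_sum:
  assumes "(\<lambda>(m, k). inner_term q m k j) summable_on UNIV"
  shows "((\<lambda>(m, k). inner_term q m k j) has_sum q powi (8 * (j * j)) / qpoch_inf q q) UNIV"
proof -
  let ?f = "\<lambda>L k. q powi (L * L) * (q powi (k * k) * (rq q (L - k) * rq q (k - 2 * j) * rq q (k + 2 * j)))"
  obtain s where s: "((\<lambda>(m, k). inner_term q m k j) has_sum s) UNIV"
    using assms by (auto simp: summable_on_def)
  have "((\<lambda>(L, k). ?f L k) has_sum s) UNIV"
  proof (subst has_sum_reindex_bij_witness[where i = "\<lambda>(m, k). (m + k, k)" and j = "\<lambda>(L, k). (L - k, k)"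
        and T = UNIV and h = "\<lambda>(m, k). inner_term q m k j" and s' = s])
    show "(case (case a of (L, k) \<Rightarrow> (L - k, k)) of (m, k) \<Rightarrow> inner_term q m k j) = (case a of (L, k) \<Rightarrow> ?f L k)" for a
    proof (cases a)
      case (Pair L k)
      have "q powi (k * k + L * L) = q powi (L * L) * q powi (k * k)"
        by (rule powi_mult[OF q0 q1, symmetric]) simp
      then show ?thesis
        unfolding Pair inner_term_def by (simp add: mult_ac)
    qed
  qed (use s in auto)
  then have "((\<lambda>L. q powi (L * L) * (q powi ((2 * j) * (2 * j)) * (rq q (L - 2 * j) * rq q (L + 2 * j)))) has_sum s) UNIV"
    unfolding UNIV_Times_UNIV[symmetric]
    by (rule has_sum_SigmaD) (simp only: prod.case, intro has_sum_cmult_right bailey_lemma_unit[OF q0 q1])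
  moreover have "((\<lambda>L. q powi ((2 * j) * (2 * j)) * (q powi (L * L) * (rq q (L - 2 * j) * rq q (L + 2 * j)))) has_sum
      q powi ((2 * j) * (2 * j)) * (q powi ((2 * j) * (2 * j)) / qpoch_inf q q)) UNIV"
    by (intro has_sum_cmult_right bailey_lemma_unit_limit[OF q0 q1])
  ultimately have "s = q powi ((2 * j) * (2 * j)) * (q powi ((2 * j) * (2 * j)) / qpoch_inf q q)"
    by (intro has_sum_unique) (simp_all add: mult.left_commute)
  also have "\<dots> = (q powi ((2 * j) * (2 * j)) * q powi ((2 * j) * (2 * j))) / qpoch_inf q q"
    by simp
  also have "q powi ((2 * j) * (2 * j)) * q powi ((2 * j) * (2 * j)) = q powi (8 * (j * j))"
    by (rule powi_mult[OF q0 q1]) simp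
  finally show ?thesis
    using s by simp
qed

text \<open>The triple product in base q^21 at w = q^11, since 21 j(j-1)/2 + 11j = j(5j+1)/2 +
  8j^2.\<close>

lemma theta_21_sum:
  "((\<lambda>j. theta_coeff q j * q powi (8 * (j * j))) has_sum qpoch_inf_list [q ^ 21, q ^ 10, q ^ 11] (q ^ 21)) UNIV"
proof -
  let ?Q = "q ^ 21" and ?w = "q ^ 11"
  have "norm ?Q \<le> norm q ^ 1"
    unfolding norm_power using q1 by (intro power_decreasing) auto
  then have Q: "?Q \<noteq> 0" "norm ?Q < 1"
    using q0 q1 by auto
  have "?w * q ^ 10 = ?Q"
    by (simp flip: power_add)
  then have d: "?Q / ?w = q ^ 10"
    using q0 by (simp add: field_simps)
  have "((\<lambda>j. qpoch_inf ?Q ?Q * (par j * ?Q powi tri (j - 1) * ?w powi j / qpoch_inf ?Q ?Q)) has_sum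
      qpoch_inf ?Q ?Q * (qpoch_inf ?w ?Q * qpoch_inf (?Q / ?w) ?Q)) UNIV"
    by (intro has_sum_cmult_right jacobi_triple_product Q) (use q0 in simp)
  moreover have "qpoch_inf ?Q ?Q * (par j * ?Q powi tri (j - 1) * ?w powi j / qpoch_inf ?Q ?Q) =
      theta_coeff q j * q powi (8 * (j * j))" for j
  proof -
    have "?Q powi tri (j - 1) * ?w powi j = q powi (21 * tri (j - 1) + 11 * j)"
      unfolding power_int_power by (rule powi_mult[OF q0 q1]) simp
    also have "21 * tri (j - 1) + 11 * j = (2 * (j * j) + tri j) + 8 * (j * j)"
      using two_tri[of j] by (simp add: tri_diff1)
    also have "q powi \<dots> = q powi (2 * (j * j) + tri j) * q powi (8 * (j * j))"
      by (rule powi_mult[OF q0 q1 refl, symmetric])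
    finally show ?thesis
      using qpoch_inf_nonzero[OF Q(2)] by (simp add: theta_coeff_def mult.assoc)
  qed
  ultimately show ?thesis
    by (simp add: d qpoch_inf_list_def mult_ac)
qed

text \<open>One absolutely convergent sum over \<open>m\<close>, \<open>k\<close>, \<open>j\<close>
  is grouped in two ways. Grouping by \<open>(m, k)\<close> gives the wanted triple sum through
  \<open>inner_sums_agree\<close>; grouping by \<open>j\<close> gives the theta series over
  (q)_\<infinity>.\<close>

lemma triple_sum_int:
  "((\<lambda>((m, k), n). triple_term q m k n) has_sum
     qpoch_inf_list [q ^ 21, q ^ 10, q ^ 11] (q ^ 21) / qpoch_inf q q) UNIV"
proof -
  let ?G = "\<lambda>((m, k), j). theta_coeff q j * inner_term q m k j"
  obtain S where S: "(?G has_sum S) UNIV"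
    using summable_inner_theta by (auto simp: summable_on_def)
  obtain s where s: "\<And>m k. ((\<lambda>j. theta_coeff q j * inner_term q m k j) has_sum s m k) UNIV"
    "\<And>m k. ((\<lambda>n. triple_term q m k n) has_sum s m k) UNIV"
    using inner_sums_agree by metis
  have S': "(?G has_sum S) (UNIV \<times> UNIV)"
    using S by simp
  have "((\<lambda>(m, k). s m k) has_sum S) UNIV"
    by (rule has_sum_SigmaD[OF S']) (auto intro: s)
  then have "((\<lambda>((m, k), n). triple_term q m k n) has_sum S) (UNIV \<times> UNIV)"
    by (rule has_sum_SigmaI[rotated]) (use summable_triple_term in \<open>auto intro: s\<close>)
  then have T: "((\<lambda>((m, k), n). triple_term q m k n) has_sum S) UNIV"
    by simp
  have sw: "((\<lambda>(j, p). case p of (m, k) \<Rightarrow> theta_coeff q j * inner_term q m k j) has_sum S) (UNIV \<times> UNIV)"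
    using S' by (subst has_sum_swap) (simp add: case_prod_unfold)
  have "((\<lambda>j. theta_coeff q j * (q powi (8 * (j * j)) / qpoch_inf q q)) has_sum S) UNIV"
  proof (rule has_sum_SigmaD[OF sw])
    fix j :: int
    \<comment> \<open>Nonvanishing lets the coefficient be divided out of the slice at
      \<open>j\<close>, so that \<open>inner_term\<close> itself is summable.\<close>
    have nz: "theta_coeff q j \<noteq> 0"
      using q0 by (simp add: theta_coeff_def par_def)
    have "(\<lambda>p. case p of (m, k) \<Rightarrow> theta_coeff q j * inner_term q m k j) summable_on UNIV"
      using summable_on_SigmaD1[OF has_sum_imp_summable[OF sw]] by simp
    then have "(\<lambda>p. theta_coeff q j * (case p of (m, k) \<Rightarrow> inner_term q m k j)) summable_on UNIV"
      by (simp add: case_prod_unfold)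
    then have "(\<lambda>(m, k). inner_term q m k j) summable_on UNIV"
      using summable_on_cmult_right'[OF nz] by blast
    from has_sum_cmult_right[OF inner_term_double_sum[OF this], of "theta_coeff q j"]
    show "((\<lambda>p. case (j, p) of (j, p) \<Rightarrow> case p of (m, k) \<Rightarrow> theta_coeff q j * inner_term q m k j) has_sum
        theta_coeff q j * (q powi (8 * (j * j)) / qpoch_inf q q)) UNIV"
      by (simp add: case_prod_unfold)
  qed
  moreover have "((\<lambda>j. theta_coeff q j * q powi (8 * (j * j)) * (1 / qpoch_inf q q)) has_sum
      qpoch_inf_list [q ^ 21, q ^ 10, q ^ 11] (q ^ 21) * (1 / qpoch_inf q q)) UNIV"
    by (rule has_sum_cmult_left[OF theta_21_sum])
  ultimately have "S = qpoch_inf_list [q ^ 21, q ^ 10, q ^ 11] (q ^ 21) / qpoch_inf q q"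
    by (intro has_sum_unique) simp_all
  with T show ?thesis
    by simp
qed

section \<open>Return to nonnegative indices\<close>

lemma triple_term_of_nat:
  "triple_term q (int m) (int k) (int n) =
     q ^ (k\<^sup>2 + (m + k)\<^sup>2 + n\<^sup>2) / (qpoch q q m * qpoch q q (2 * k)) * qbinom q k n"
proof -
  have "int k * int k + (int m + int k) * (int m + int k) + int n * int n = int (k\<^sup>2 + (m + k)\<^sup>2 + n\<^sup>2)"
    by (simp add: power2_eq_square)
  then have "q powi (int k * int k + (int m + int k) * (int m + int k) + int n * int n) = q ^ (k\<^sup>2 + (m + k)\<^sup>2 + n\<^sup>2)"
    by (simp only: power_int_of_nat)
  moreover have "gbin q k (int n) = qbinom q k n"
    by (auto simp: gbin_def qbinom_def rq_def nat_diff_distrib')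
  ultimately show ?thesis
    by (simp add: triple_term_def rq_def nat_mult_distrib)
qed

end

theorem mainTheorem6:
  fixes q :: complex
  assumes "norm q < 1"
  shows "((\<lambda>(m, k, n). q ^ (k\<^sup>2 + (m + k)\<^sup>2 + n\<^sup>2) / (qpoch q q m * qpoch q q (2 * k)) * qbinom q k n)
           has_sum (qpoch_inf_list [q ^ 21, q ^ 10, q ^ 11] (q ^ 21) / qpoch_inf q q))
           (UNIV :: (nat \<times> nat \<times> nat) set)"
proof (cases "q = 0")
  \<comment> \<open>Integer powers of \<open>q\<close> require \<open>q \<noteq> 0\<close>, so this
    case is separate: only the term at (0, 0, 0) survives, and every product equals 1.\<close>
  case True
  have "qpoch_inf 0 0 = 1"
    by (simp add: qpoch_inf_def)
  moreover have "((\<lambda>(m, k, n). 0 ^ (k\<^sup>2 + (m + k)\<^sup>2 + n\<^sup>2) / (qpoch 0 0 m * qpoch 0 0 (2 * k)) * qbinom 0 k n) has_sum 1)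
      (UNIV :: (nat \<times> nat \<times> nat) set)"
    by (rule has_sum_finite_neutralI[where B = "{(0, 0, 0)}"])
      (auto simp: qpoch_def qbinom_def power_0_left split: if_splits)
  ultimately show ?thesis
    unfolding True by (simp add: qpoch_inf_list_def)
next
  case False
  let ?h = "\<lambda>(m, k, n). ((int m, int k), int n)"
  let ?t = "\<lambda>((m, k), n). triple_term q m k n"
  \<comment> \<open>Terms with a negative index vanish, so the integer sum restricts to the image of
    the natural triples, regrouped by \<open>?h\<close>.\<close>
  have "?t p = 0" if "p \<notin> range ?h" for p
  proof -
    obtain m k n where p: "p = ((m, k), n)"
      by (metis prod.exhaust)
    have "m < 0 \<or> k < 0 \<or> n < 0"
    proof (rule ccontr)
      assume "\<not> ?thesis"
      then have "p = ?h (nat m, nat k, nat n)"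
        by (simp add: p)
      then show False
        using that by blast
    qed
    then show ?thesis
      unfolding p triple_term_def by (auto simp: rq_neg gbin_outside)
  qed
  then have "(?t has_sum (qpoch_inf_list [q ^ 21, q ^ 10, q ^ 11] (q ^ 21) / qpoch_inf q q)) (range ?h)"
    using triple_sum_int[OF False assms]
    by (subst has_sum_cong_neutral[where T = UNIV and g = ?t]) auto
  then have "((?t \<circ> ?h) has_sum (qpoch_inf_list [q ^ 21, q ^ 10, q ^ 11] (q ^ 21) / qpoch_inf q q)) UNIV"
    by (subst (asm) has_sum_reindex) (auto simp: inj_on_def)
  then show ?thesis
    by (simp add: o_def case_prod_unfold triple_term_of_nat[OF False assms])
qed

end
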